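(* Let $\mathcal H$ be a real separable infinite-dimensional Hilbert space and let $\nu$ be a mean-zero symmetric Laplace measure on $\mathcal H$ with covariance operator $C$. Then $\operatorname{supp}(\nu)=\mathcal H$ if the eigenvalues $\{\lambda_k\}_{k\ge1}$ of $C$ satisfy the following: for any fixed $r\in\mathbb R\setminus\{0\}$ and any real-valued sequence $\{w_k\}_{k\ge1}$ with $\sum_{k=1}^\infty w_k^2<\infty$, $$\limsup_{M\to\infty}\frac{\mathrm P\Big[\sum_{k=1}^M\{\sqrt{\lambda_k}(L_k+L_k')-w_k\}^2\le r^2\Big]}{\mathrm P\Big\{\sum_{k=1}^M(\sqrt{\lambda_k}L_k-w_k)^2\le r^2\Big\}}<\infty,$$ where, for each $M$, $(L_1,\dots,L_M)^{\mathsf T}$ and $(L_1',\dots,L_M')^{\mathsf T}$ are i.i.d. mean-zero Laplace random vectors in $\mathbb R^M$ with identity covariance matrices.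
   Context: $\langle\cdot,\cdot\rangle$ is the inner product of $\mathcal H$. A Borel probability measure $\nu$ on $\mathcal H$ is a Laplace measure if for every $x\in\mathcal H$, $x\neq 0$, the function $t\mapsto\nu\{y\in\mathcal H:\langle x,y\rangle\le t\}$ is the cumulative distribution function of a Laplace distribution on $\mathbb R$ with mean $\mu_x\in\mathbb R$ and variance $2b_x^2>0$, i.e. with density $t\mapsto(2b_x)^{-1}\exp(-|t-\mu_x|/b_x)$. Its mean $\mu$ and covariance operator $C$ are defined by $\langle\mu,x\rangle=\int_{\mathcal H}\langle w,x\rangle\,\nu(\mathrm dw)$ and $\langle Cx,y\rangle=\int_{\mathcal H}\langle x,w-\mu\rangle\langle y,w-\mu\rangle\,\nu(\mathrm dw)$. Symmetric means $\nu(B)=\nu(-B)$ for every Borel set $B$. The multivariate Laplace distribution on $\mathbb R^p$ with mean $m$ and covariance matrix $\Sigma$ is the distribution with characteristic function $t\mapsto\exp(\mathrm i m^{\mathsf T}t)(1+t^{\mathsf T}\Sigma t/2)^{-1}$. Eigenvalues are listed with multiplicity. *)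

theory Defs
  imports "HOL-Probability.Probability" "HOL-Library.Equipollence"
begin

definition laplace_density :: "real \<Rightarrow> real \<Rightarrow> real \<Rightarrow> real" where
  "laplace_density m b t = exp (- \<bar>t - m\<bar> / b) / (2 * b)"

definition laplace_measure :: "'a::{real_inner, polish_space} measure \<Rightarrow> bool" where
  "laplace_measure \<nu> \<longleftrightarrow>
     prob_space \<nu> \<and> sets \<nu> = sets borel \<and>
     (\<forall>x. x \<noteq> 0 \<longrightarrow> (\<exists>m b. b > 0 \<and>
        (\<forall>t. measure \<nu> {y. inner x y \<le> t} =
             cdf (density lborel (\<lambda>s. ennreal (laplace_density m b s))) t)))"

(* Bochner integrals of non-integrable functions are 0 by convention, so integrability is
   part of the definitions of mean and covariance; it holds for every Laplace measure. *)
definition is_mean :: "'a::{real_inner, polish_space} measure \<Rightarrow> 'a \<Rightarrow> bool" where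
  "is_mean \<nu> \<mu> \<longleftrightarrow>
     (\<forall>x. integrable \<nu> (\<lambda>w. inner w x) \<and> inner \<mu> x = (\<integral>w. inner w x \<partial>\<nu>))"

definition is_covariance_operator ::
    "'a::{real_inner, polish_space} measure \<Rightarrow> 'a \<Rightarrow> ('a \<Rightarrow> 'a) \<Rightarrow> bool" where
  "is_covariance_operator \<nu> \<mu> C \<longleftrightarrow>
     (\<forall>x y. integrable \<nu> (\<lambda>w. inner x (w - \<mu>) * inner y (w - \<mu>)) \<and>
            inner (C x) y = (\<integral>w. inner x (w - \<mu>) * inner y (w - \<mu>) \<partial>\<nu>))"

definition symmetric_measure :: "'a::{real_inner, polish_space} measure \<Rightarrow> bool" where
  "symmetric_measure \<nu> \<longleftrightarrow> (\<forall>B\<in>sets borel. emeasure \<nu> B = emeasure \<nu> (uminus ` B))"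

definition measure_support :: "'a::topological_space measure \<Rightarrow> 'a set" where
  "measure_support \<nu> = {x. \<forall>U. open U \<and> x \<in> U \<longrightarrow> emeasure \<nu> U > 0}"

(* Every real number l occurs in the sequence as often as the dimension of its eigenspace
   (not at all if l is not an eigenvalue); no particular order is imposed. *)
definition eigenvalues_with_multiplicity ::
    "('a::real_vector \<Rightarrow> 'a) \<Rightarrow> (nat \<Rightarrow> real) \<Rightarrow> bool" where
  "eigenvalues_with_multiplicity C lam \<longleftrightarrow>
     (\<forall>l. \<exists>B. independent B \<and> span B = {x. C x = l *\<^sub>R x} \<and> {k. lam k = l} \<approx> B)"

(* The dimension p varies inside statements, so R^p is represented by the product space
   PiM {..<p} (\<lambda>_. borel), with coordinates numbered 0, ..., p - 1. *)
definition multivariate_laplace ::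
    "nat \<Rightarrow> (nat \<Rightarrow> real) \<Rightarrow> (nat \<Rightarrow> nat \<Rightarrow> real) \<Rightarrow> (nat \<Rightarrow> real) measure \<Rightarrow> bool" where
  "multivariate_laplace p m \<Sigma> N \<longleftrightarrow>
     prob_space N \<and> sets N = sets (PiM {..<p} (\<lambda>_. borel)) \<and>
     (\<forall>t. (CLINT x|N. iexp (\<Sum>j<p. t j * x j)) =
          iexp (\<Sum>j<p. m j * t j) /
            complex_of_real (1 + (\<Sum>j<p. \<Sum>k<p. t j * \<Sigma> j k * t k) / 2))"

end

theory Submission
  imports Defs
begin

text \<open>
  The measure \<open>\<nu>\<close> is a Gaussian scale mixture, and this makes its null sets invariant under enough
  translations. By the definition of mean and covariance, the functional \<open>inner x\<close> has under \<open>\<nu>\<close>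
  the centered Laplace distribution with variance \<open>inner (C x) x\<close>, so its characteristic function at
  \<open>1\<close> is \<open>1 / (1 + inner (C x) x / 2)\<close>; in particular \<open>inner (C x) x > 0\<close> for \<open>x \<noteq> 0\<close>. Let \<open>u\<close> be
  a sequence that is orthonormal for the form \<open>inner (C x) y\<close>. The joint characteristic function
  of the coordinates \<open>inner (u k)\<close> is then that of \<open>sqrt s * g k\<close>, where \<open>g\<close> is an independent
  standard normal sequence and \<open>s\<close> an independent exponential variable. Uniqueness of
  characteristic functions (\<open>measure_eqI_PiM_cos\<close>) makes the two joint laws equal
  (\<open>distr_orthonormal_coordinates\<close>).

  For given \<open>s > 0\<close>, shifting the normal variable \<open>g 0\<close> by a constant preserves null sets. Hence
  null sets of the joint law are preserved by shifts of coordinate \<open>0\<close>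
  (\<open>AE_laplace_sequence_shift\<close>). On the Hilbert space, the shift of coordinate \<open>0\<close> by a constant
  \<open>a\<close> is the translation by \<open>a *\<^sub>R C (u 0)\<close>. As the direction of \<open>u 0\<close> is arbitrary, and closed balls
  are countable intersections of conditions on finitely many coordinates, translations by any \<open>C v\<close>
  map null balls to null balls (\<open>cball_null_translate\<close>).

  The support is nonempty by separability, it is closed, and it is invariant under translation by
  the range of \<open>C\<close>. This range is dense, because a vector \<open>z\<close> orthogonal to it satisfies
  \<open>inner (C z) z = 0\<close> and so vanishes. Therefore the support is the whole space (\<open>full_support\<close>).
\<close>

section \<open>Integrals of Laplace densities\<close>

lemma has_bochner_integral_power_exp_half_line:
  "has_bochner_integral lborel (\<lambda>x::real. indicator {0..} x *\<^sub>R (exp (-x) * x ^ k)) (fact k)"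
proof (rule has_bochner_integral_nn_integral)
  show "(\<integral>\<^sup>+x. ennreal (indicator {0..} x *\<^sub>R (exp (-x) * x ^ k)) \<partial>lborel) = ennreal (fact k)"
    unfolding nn_intergal_power_times_exp_Ici[of k, simplified of_nat_fact, symmetric]
    by (intro nn_integral_cong) (auto simp: indicator_def mult.commute)
qed (auto simp: indicator_def)

lemma has_bochner_integral_cos_exp_half_line:
  fixes t :: real
  shows "has_bochner_integral lborel (\<lambda>x::real. indicator {0..} x *\<^sub>R (exp (-x) * cos (t * x))) (1 / (1 + t\<^sup>2))"
proof -
  let ?f = "\<lambda>x::real. exp (-x) * cos (t * x)"
  let ?F = "\<lambda>x::real. exp (-x) * (t * sin (t * x) - cos (t * x)) / (1 + t\<^sup>2)"
  have nz: "1 + t\<^sup>2 \<noteq> 0" by (smt (verit) zero_le_power2)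
  have int: "integrable lborel (\<lambda>x. indicator {0..} x *\<^sub>R ?f x)"
  proof (rule Bochner_Integration.integrable_bound)
    show "integrable lborel (\<lambda>x::real. indicator {0..} x *\<^sub>R (exp (-x) * x ^ 0))"
      using has_bochner_integral_power_exp_half_line[of 0] by (rule integrable.intros)
  qed (auto simp: indicator_def abs_mult intro!: mult_left_le)
  have int': "set_integrable lborel (einterval 0 \<infinity>) ?f"
    unfolding set_integrable_def
    by (rule Bochner_Integration.integrable_bound[OF int])
       (auto simp: indicator_def einterval_def)
  have "(LBINT x=0..\<infinity>. ?f x) = 0 - (- 1 / (1 + t\<^sup>2))"
  proof (rule interval_integral_FTC_integrable[where F = ?F])
    fix x :: real
    show "(?F has_vector_derivative ?f x) (at x)"
    proof -
      have "((\<lambda>x. exp (-x) * (t * sin (t * x) - cos (t * x))) has_real_derivative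
          (exp (-x) * (t * (cos (t * x) * t) + sin (t * x) * t) - exp (-x) * (t * sin (t * x) - cos (t * x)))) (at x)"
        by (auto intro!: derivative_eq_intros simp: algebra_simps)
      then have "(?F has_real_derivative
          (exp (-x) * (t * (cos (t * x) * t) + sin (t * x) * t) - exp (-x) * (t * sin (t * x) - cos (t * x))) / (1 + t\<^sup>2)) (at x)"
        by (rule DERIV_cdivide)
      also have "(exp (-x) * (t * (cos (t * x) * t) + sin (t * x) * t) - exp (-x) * (t * sin (t * x) - cos (t * x))) / (1 + t\<^sup>2) = ?f x"
        using nz by (simp add: field_simps power2_eq_square)
      finally show ?thesis by (simp add: has_real_derivative_iff_has_vector_derivative)
    qed
    show "isCont ?f x" by (intro continuous_intros)
  next
    have "(?F \<longlongrightarrow> ?F 0) (at_right 0)"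
      by (intro tendsto_intros tendsto_within_subset[OF isContD] nz continuous_intros) (use nz in auto)
    then show "((?F \<circ> real_of_ereal) \<longlongrightarrow> - 1 / (1 + t\<^sup>2)) (at_right 0)"
      by (simp only: zero_ereal_def ereal_tendsto_simps1) simp
  next
    have "((\<lambda>x. exp (-x) * (\<bar>t\<bar> + 1)) \<longlongrightarrow> 0 * (\<bar>t\<bar> + 1)) at_top"
      by (intro tendsto_intros filterlim_compose[OF exp_at_bot] filterlim_uminus_at_bot_at_top)
    then have lim: "((\<lambda>x. exp (-x) * (\<bar>t\<bar> + 1)) \<longlongrightarrow> 0) at_top" by simp
    have "((\<lambda>x. exp (-x) * (t * sin (t * x) - cos (t * x))) \<longlongrightarrow> 0) at_top"
    proof (rule tendsto_rabs_zero_cancel, rule tendsto_sandwich[OF _ _ tendsto_const lim])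
      have "\<bar>t * sin (t * x) - cos (t * x)\<bar> \<le> \<bar>t\<bar> + 1" for x
      proof -
        have "\<bar>t * sin (t * x)\<bar> \<le> \<bar>t\<bar>" by (simp add: abs_mult mult_left_le)
        moreover have "\<bar>cos (t * x)\<bar> \<le> 1" by simp
        ultimately show ?thesis by linarith
      qed
      then show "\<forall>\<^sub>F x in at_top. \<bar>exp (- x) * (t * sin (t * x) - cos (t * x))\<bar> \<le> exp (- x) * (\<bar>t\<bar> + 1)"
        by (auto simp: abs_mult)
    qed auto
    then have "(?F \<longlongrightarrow> 0 / (1 + t\<^sup>2)) at_top"
      by (intro tendsto_intros nz)
    then show "((?F \<circ> real_of_ereal) \<longlongrightarrow> 0) (at_left \<infinity>)"
      by (simp only: ereal_tendsto_simps1) simp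
  qed (use int' in auto)
  also have "(LBINT x=0..\<infinity>. ?f x) = (\<integral>x. indicator {0<..} x *\<^sub>R ?f x \<partial>lborel)"
    by (simp add: interval_lebesgue_integral_def set_lebesgue_integral_def einterval_def
        zero_ereal_def greaterThan_def)
  also have "\<dots> = (\<integral>x. indicator {0..} x *\<^sub>R ?f x \<partial>lborel)"
    by (rule integral_cong_AE) (use AE_lborel_singleton[of "0::real"] in \<open>auto simp: indicator_def elim!: eventually_mono\<close>)
  finally show ?thesis
    using int by (simp add: has_bochner_integral_iff)
qed

text \<open>
  The substitution \<open>x \<mapsto> m + b * x\<close> reduces every integral against a Laplace density to one
  against \<open>exp (- \<bar>x\<bar>)\<close>, which is twice the standard Laplace density; hence the factor \<open>2\<close>.
\<close>

lemma has_bochner_integral_laplace_density: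
  assumes b: "b > 0"
    and f: "has_bochner_integral lborel (\<lambda>x. exp (- \<bar>x\<bar>) * f (m + b * x)) (2 * I)"
  shows "has_bochner_integral lborel (\<lambda>x. laplace_density m b x * f x) I"
proof -
  have "has_bochner_integral lborel (\<lambda>x. (exp (- \<bar>x\<bar>) * f (m + b * x)) * (1 / (2 * b))) (2 * I * (1 / (2 * b)))"
    using f by (rule has_bochner_integral_mult_left) 
  also have "(\<lambda>x. (exp (- \<bar>x\<bar>) * f (m + b * x)) * (1 / (2 * b))) = (\<lambda>x. laplace_density m b (m + b * x) * f (m + b * x))"
    using b by (auto simp: laplace_density_def fun_eq_iff abs_mult)
  also have "2 * I * (1 / (2 * b)) = I /\<^sub>R \<bar>b\<bar>"
    using b by (simp add: field_simps)
  finally show ?thesis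
    using b by (subst lborel_has_bochner_integral_real_affine_iff[where c = b and t = m]) auto
qed

text \<open>
  Even integrands are twice their integral over the half line and odd ones vanish. Carrying the
  phase \<open>\<theta>\<close> makes the cosine transform as informative as the characteristic function, while
  everything stays real.
\<close>

lemma laplace_density_integrals:
  assumes b: "b > 0"
  shows laplace_density_integral_1: "has_bochner_integral lborel (laplace_density m b) 1" (is ?total)
    and laplace_density_mean: "has_bochner_integral lborel (\<lambda>x. laplace_density m b x * x) m" (is ?mean)
    and laplace_density_second_moment: "has_bochner_integral lborel (\<lambda>x. laplace_density 0 b x * x\<^sup>2) (2 * b\<^sup>2)" (is ?second)
    and laplace_density_cos_transform: 
      "has_bochner_integral lborel (\<lambda>x. laplace_density 0 b x * cos (t * x + \<theta>)) (cos \<theta> / (1 + t\<^sup>2 * b\<^sup>2))" (is ?cos)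
proof -
  have half: "has_bochner_integral lborel (\<lambda>x::real. indicator {0..} x *\<^sub>R (exp (-\<bar>x\<bar>) * x ^ k)) (fact k)" for k
    using has_bochner_integral_power_exp_half_line[of k]
    by (rule has_bochner_integral_cong[THEN iffD1, rotated -1]) (auto simp: indicator_def)
  have half_cos: "has_bochner_integral lborel (\<lambda>x::real. indicator {0..} x *\<^sub>R (exp (-\<bar>x\<bar>) * cos (t * b * x))) (1 / (1 + (t * b)\<^sup>2))"
    using has_bochner_integral_cos_exp_half_line[of "t * b"]
    by (rule has_bochner_integral_cong[THEN iffD1, rotated -1]) (auto simp: indicator_def)
  have m0: "has_bochner_integral lborel (\<lambda>x::real. exp (-\<bar>x\<bar>)) 2"
    using has_bochner_integral_even_function[OF half[of 0]] by simp
  have m1: "has_bochner_integral lborel (\<lambda>x::real. exp (-\<bar>x\<bar>) * x) 0"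
    using has_bochner_integral_odd_function[OF half[of 1]] by simp
  have m2: "has_bochner_integral lborel (\<lambda>x::real. exp (-\<bar>x\<bar>) * x\<^sup>2) 4"
    using has_bochner_integral_even_function[OF half[of 2]] by (simp add: fact_numeral)
  have c: "has_bochner_integral lborel (\<lambda>x::real. exp (-\<bar>x\<bar>) * cos (t * b * x)) (2 / (1 + (t * b)\<^sup>2))"
    using has_bochner_integral_even_function[OF half_cos] by simp
  have s: "has_bochner_integral lborel (\<lambda>x::real. exp (-\<bar>x\<bar>) * sin (t * b * x)) 0"
  proof (rule has_bochner_integral_odd_function)
    show "has_bochner_integral lborel (\<lambda>x::real. indicator {0..} x *\<^sub>R (exp (-\<bar>x\<bar>) * sin (t * b * x)))
        (\<integral>x. indicator {0..} x *\<^sub>R (exp (-\<bar>x\<bar>) * sin (t * b * x)) \<partial>lborel)"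
      by (intro has_bochner_integral_integrable Bochner_Integration.integrable_bound[OF integrable.intros[OF half[of 0]]])
         (auto simp: indicator_def abs_mult intro!: mult_left_le)
  qed auto
  show ?total
    using has_bochner_integral_laplace_density[OF b, of "\<lambda>_. 1" m 1] m0 by simp
  have "has_bochner_integral lborel (\<lambda>x::real. exp (-\<bar>x\<bar>) * m + (exp (-\<bar>x\<bar>) * x) * b) (2 * m + 0 * b)"
    by (intro has_bochner_integral_add has_bochner_integral_mult_left m0 m1)
  then show ?mean
    by (intro has_bochner_integral_laplace_density[OF b]) (simp add: algebra_simps)
  have "has_bochner_integral lborel (\<lambda>x::real. exp (-\<bar>x\<bar>) * x\<^sup>2 * b\<^sup>2) (4 * b\<^sup>2)"
    by (intro has_bochner_integral_mult_left m2)
  then show ?second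
    by (intro has_bochner_integral_laplace_density[OF b]) (simp add: algebra_simps)
  have "has_bochner_integral lborel (\<lambda>x::real. exp (-\<bar>x\<bar>) * cos (t * b * x) * cos \<theta> - exp (-\<bar>x\<bar>) * sin (t * b * x) * sin \<theta>)
      (2 / (1 + (t * b)\<^sup>2) * cos \<theta> - 0 * sin \<theta>)"
    by (intro has_bochner_integral_diff has_bochner_integral_mult_left c s)
  then show ?cos
    by (intro has_bochner_integral_laplace_density[OF b])
       (simp add: algebra_simps cos_add power_mult_distrib)
qed

section \<open>Uniqueness of the cosine transform\<close>

text \<open>
  The phases \<open>\<theta> = 0\<close> and \<open>\<theta> = - pi / 2\<close> give the real and imaginary part of the characteristic
  function, so this is Levy's uniqueness theorem after normalization to total mass one. Measures of
  arbitrary finite mass are admitted because the proof for sequences applies the lemma to densities.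
\<close>

lemma finite_borel_measure_eqI_cos:
  fixes M N :: "real measure"
  assumes "finite_measure M" "finite_measure N"
    and sets[measurable_cong]: "sets M = sets borel" "sets N = sets borel"
    and eq: "\<And>t \<theta>. (\<integral>x. cos (t * x + \<theta>) \<partial>M) = (\<integral>x. cos (t * x + \<theta>) \<partial>N)"
  shows "M = N"
proof -
  interpret M: finite_measure M by fact
  interpret N: finite_measure N by fact
  have space: "space M = UNIV" "space N = UNIV"
    using sets_eq_imp_space_eq[OF sets(1)] sets_eq_imp_space_eq[OF sets(2)] by auto
  define c where "c = measure M UNIV"
  have cM: "emeasure M UNIV = ennreal c"
    unfolding c_def by (rule M.emeasure_eq_measure)
  have cN: "emeasure N UNIV = ennreal c"
    using eq[of 0 0] by (simp add: space c_def N.emeasure_eq_measure)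
  show ?thesis
  proof (cases "c = 0")
    case True
    have "emeasure M A = 0" "emeasure N A = 0" for A
      using emeasure_mono[of A UNIV M] emeasure_mono[of A UNIV N] cM cN True sets
      by (auto simp: not_gr_zero sets_eq_imp_space_eq)
    then show ?thesis by (intro measure_eqI) (simp_all add: sets)
  next
    case False
    then have c: "c > 0" by (simp add: c_def zero_less_measure_iff)
    define normalized where "normalized L = density L (\<lambda>_. ennreal (1 / c))" for L :: "real measure"
    have em: "emeasure (normalized L) A = ennreal (1 / c) * emeasure L A" if "A \<in> sets L" for L A
      unfolding normalized_def by (rule emeasure_density_const[OF that])
    have int: "(\<integral>x. f x \<partial>normalized L) = (\<integral>x. f x \<partial>L) / c"
      if "f \<in> borel_measurable L" for L and f :: "real \<Rightarrow> real"
      using that c unfolding normalized_def by (subst integral_density) auto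
    have one: "ennreal (1 / c) * ennreal c = 1"
      using c by (subst ennreal_mult[symmetric]) auto
    have dist: "real_distribution (normalized M)" "real_distribution (normalized N)"
      using em[of UNIV M] em[of UNIV N] cM cN one
      by (auto simp: real_distribution_def real_distribution_axioms_def normalized_def sets space
               intro!: prob_spaceI)
    interpret M': real_distribution "normalized M" by (rule dist)
    interpret N': real_distribution "normalized N" by (rule dist)
    have cos_eq: "(\<integral>x. cos (t * x + \<theta>) \<partial>normalized M) = (\<integral>x. cos (t * x + \<theta>) \<partial>normalized N)" for t \<theta>
      by (simp add: int eq)
    have "char (normalized M) = char (normalized N)"
    proof
      fix t
      have I: "integrable (normalized M) (\<lambda>x. iexp (t * x))" "integrable (normalized N) (\<lambda>x. iexp (t * x))"
        by (auto intro!: M'.integrable_iexp N'.integrable_iexp simp del: of_real_mult)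
      have "Re (char (normalized M) t) = Re (char (normalized N) t)"
        unfolding char_def using cos_eq[of t 0]
        by (subst (1 2) integral_Re[symmetric]) (use I in \<open>auto simp: Re_exp simp del: of_real_mult\<close>)
      moreover have "Im (char (normalized M) t) = Im (char (normalized N) t)"
        unfolding char_def using cos_eq[of t "- pi / 2"]
        by (subst (1 2) integral_Im[symmetric]) (use I in \<open>auto simp: Im_exp cos_diff simp del: of_real_mult\<close>)
      ultimately show "char (normalized M) t = char (normalized N) t"
        by (simp add: complex_eq_iff)
    qed
    then have eq': "normalized M = normalized N"
      by (rule Levy_uniqueness[OF dist])
    show ?thesis
    proof (rule measure_eqI)
      fix A assume A: "A \<in> sets M"
      have "ennreal (1 / c) * emeasure M A = ennreal (1 / c) * emeasure N A"
        using A eq' by (simp add: em[symmetric] sets)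
      then show "emeasure M A = emeasure N A"
        using c by (subst (asm) ennreal_mult_cancel_left) auto
    qed (simp add: sets)
  qed
qed

lemma linear_combination_add_coordinate:
  fixes t :: "'i \<Rightarrow> real"
  assumes "finite K"
  obtains K' t' where "finite K'" "\<And>x. (\<Sum>k\<in>K'. t' k * x k) = (\<Sum>k\<in>K. t k * x k) + \<tau> * x j"
proof
  let ?t' = "\<lambda>k. (if k \<in> K then t k else 0) + (if k = j then \<tau> else 0)"
  show "finite (insert j K)" using assms by simp
  show "(\<Sum>k\<in>insert j K. ?t' k * x k) = (\<Sum>k\<in>K. t k * x k) + \<tau> * x j" for x
  proof -
    have "(\<Sum>k\<in>insert j K. ?t' k * x k) =
        (\<Sum>k\<in>insert j K. if k \<in> K then t k * x k else 0) + (\<Sum>k\<in>insert j K. if k = j then \<tau> * x k else 0)"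
      by (subst sum.distrib[symmetric]) (intro sum.cong, auto simp: algebra_simps)
    also have "(\<Sum>k\<in>insert j K. if k \<in> K then t k * x k else 0) = (\<Sum>k\<in>K. t k * x k)"
      using assms by (intro sum.mono_neutral_cong_right) auto
    also have "(\<Sum>k\<in>insert j K. if k = j then \<tau> * x k else 0) = \<tau> * x j"
      using assms by simp
    finally show ?thesis .
  qed
qed

lemma prod_indicator_bounds:
  fixes J :: "'i set" and A :: "'i \<Rightarrow> 'b set"
  shows "0 \<le> (\<Prod>j\<in>J. indicator (A j) (x j) :: real)" "(\<Prod>j\<in>J. indicator (A j) (x j) :: real) \<le> 1"
  by (auto intro!: prod_nonneg prod_le_1)

text \<open>
  Uniqueness in many dimensions is obtained one coordinate at a time. Suppose that the integrals of
  \<open>f x * cos (\<dots> + \<theta>)\<close> agree for both measures, where \<open>f\<close> is the indicator of constraints on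
  the coordinates in \<open>J\<close>. The nonnegative weight \<open>f x * (1 + cos (S x + \<theta>))\<close>, with \<open>S\<close> a linear
  combination of coordinates, turns each measure into a finite measure whose image under a further
  coordinate \<open>j\<close> is a measure on the line. By the product formula for cosines, the cosine
  transforms of these images are again integrals of the given kind, so the images are equal, and a
  constraint on coordinate \<open>j\<close> can be added to \<open>f\<close>.
\<close>

proposition measure_eqI_PiM_cos:
  fixes P Q :: "('i \<Rightarrow> real) measure"
  assumes "prob_space P" "prob_space Q"
    and sets[measurable_cong]: "sets P = sets (PiM UNIV (\<lambda>_. borel))" "sets Q = sets (PiM UNIV (\<lambda>_. borel))"
    and eq: "\<And>K t \<theta>. finite K \<Longrightarrow>
      (\<integral>x. cos ((\<Sum>k\<in>K. t k * x k) + \<theta>) \<partial>P) = (\<integral>x. cos ((\<Sum>k\<in>K. t k * x k) + \<theta>) \<partial>Q)"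
  shows "P = Q"
proof -
  interpret P: prob_space P by fact
  interpret Q: prob_space Q by fact
  let ?ind = "\<lambda>J A x. \<Prod>j\<in>J. indicator (A j) (x j) :: real"
  have [measurable]: "(\<lambda>x. x i) \<in> borel_measurable P" "(\<lambda>x. x i) \<in> borel_measurable Q" for i
    by measurable
  have trig: "f * (1 + cos (S + \<theta>)) * cos (y + \<phi>) =
      f * cos (y + \<phi>) + (f * cos (S + y + (\<theta> + \<phi>)) + f * cos (S - y + (\<theta> - \<phi>))) / 2" for f S \<theta> y \<phi> :: real
  proof -
    have "cos (S + \<theta>) * cos (y + \<phi>) = (cos (S + y + (\<theta> + \<phi>)) + cos (S - y + (\<theta> - \<phi>))) / 2"
      by (simp add: cos_times_cos algebra_simps)
    then show ?thesis by (simp add: algebra_simps)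
  qed
  have main: "(\<integral>x. ?ind J A x * cos ((\<Sum>k\<in>K. t k * x k) + \<theta>) \<partial>P) =
      (\<integral>x. ?ind J A x * cos ((\<Sum>k\<in>K. t k * x k) + \<theta>) \<partial>Q)"
    if "finite J" "\<And>j. j \<in> J \<Longrightarrow> A j \<in> sets borel" "finite K" for J A K t \<theta>
    using that
  proof (induction J arbitrary: K t \<theta> rule: finite_induct)
    case empty
    then show ?case by (simp add: eq)
  next
    case (insert j J)
    have [measurable]: "A j \<in> sets borel" and A[measurable]: "\<And>i. i \<in> J \<Longrightarrow> A i \<in> sets borel"
      using insert.prems by auto
    have ind_meas[measurable]: "?ind J A \<in> borel_measurable P" "?ind J A \<in> borel_measurable Q"
      by (measurable; simp add: A)+
    let ?L = "\<lambda>K t \<theta> x. cos ((\<Sum>k\<in>K. t k * x k) + \<theta>) :: real"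
    let ?W = "\<lambda>K t \<theta> x. ?ind J A x * (1 + ?L K t \<theta> x)"
    let ?m = "\<lambda>R K t \<theta>. distr (density R (\<lambda>x. ennreal (?W K t \<theta> x))) borel (\<lambda>x. x j)"
    have W_bounds: "0 \<le> ?W K t \<theta> x" "?W K t \<theta> x \<le> 2" for K t \<theta> x
    proof -
      have "0 \<le> 1 + ?L K t \<theta> x"
        using cos_ge_minus_one[of "(\<Sum>k\<in>K. t k * x k) + \<theta>"] by linarith
      then show "0 \<le> ?W K t \<theta> x" "?W K t \<theta> x \<le> 2"
        using prod_indicator_bounds[where J=J and A=A and x=x]
          mult_mono[of "?ind J A x" 1 "1 + ?L K t \<theta> x" 2] by auto
    qed
    have transfer: "(\<integral>y. g y \<partial>?m R K t \<theta>) = (\<integral>x. ?W K t \<theta> x * g (x j) \<partial>R)"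
      if R[measurable_cong]: "sets R = sets (PiM UNIV (\<lambda>_. borel))" and [measurable]: "g \<in> borel_measurable borel"
      for R K t \<theta> and g :: "real \<Rightarrow> real"
    proof -
      have [measurable]: "?ind J A \<in> borel_measurable R"
        by (measurable; simp add: A)
      show ?thesis
        using W_bounds(1) by (simp add: integral_distr integral_density)
    qed
    have meq: "?m P K t \<theta> = ?m Q K t \<theta>" if K: "finite K" for K t \<theta>
    proof (rule finite_borel_measure_eqI_cos)
      have fin: "finite_measure (?m R K t \<theta>)"
        if "prob_space R" and R[measurable_cong]: "sets R = sets (PiM UNIV (\<lambda>_. borel))" for R
      proof -
        interpret R: prob_space R by fact
        have [measurable]: "?ind J A \<in> borel_measurable R"
          by (measurable; simp add: A)
        have "(\<integral>\<^sup>+x. ennreal (?W K t \<theta> x) \<partial>R) \<le> (\<integral>\<^sup>+x. 2 \<partial>R)"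
          using W_bounds(2) by (intro nn_integral_mono) (metis ennreal_leI ennreal_numeral zero_le_numeral)
        then have "(\<integral>\<^sup>+x. ennreal (?W K t \<theta> x) \<partial>R) < \<infinity>"
          by (auto simp: R.emeasure_space_1 intro: le_less_trans)
        then have "finite_measure (density R (\<lambda>x. ennreal (?W K t \<theta> x)))"
          by (intro finite_measureI) (auto simp: emeasure_density cong: nn_integral_cong)
        then show ?thesis by (rule finite_measure.finite_measure_distr) measurable
      qed
      show "finite_measure (?m P K t \<theta>)" "finite_measure (?m Q K t \<theta>)"
        using fin assms by auto
    next
      fix \<tau> \<phi>
      obtain K1 t1 where 1: "finite K1" "\<And>x. (\<Sum>k\<in>K1. t1 k * x k) = (\<Sum>k\<in>K. t k * x k) + \<tau> * x j"
        using linear_combination_add_coordinate[OF K, where t=t and \<tau>=\<tau> and j=j] by blast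
      obtain K2 t2 where 2: "finite K2" "\<And>x. (\<Sum>k\<in>K2. t2 k * x k) = (\<Sum>k\<in>K. t k * x k) + (-\<tau>) * x j"
        using linear_combination_add_coordinate[OF K, where t=t and \<tau>="-\<tau>" and j=j] by blast
      have expand: "(\<integral>y. cos (\<tau> * y + \<phi>) \<partial>?m R K t \<theta>) =
         (\<integral>x. ?ind J A x * ?L {j} (\<lambda>_. \<tau>) \<phi> x \<partial>R) +
         ((\<integral>x. ?ind J A x * ?L K1 t1 (\<theta> + \<phi>) x \<partial>R) + (\<integral>x. ?ind J A x * ?L K2 t2 (\<theta> - \<phi>) x \<partial>R)) / 2"
        if "prob_space R" and R[measurable_cong]: "sets R = sets (PiM UNIV (\<lambda>_. borel))" for R
      proof -
        interpret R: prob_space R by fact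
        have [measurable]: "?ind J A \<in> borel_measurable R"
          by (measurable; simp add: A)
        have int: "integrable R (\<lambda>x. ?ind J A x * ?L K' t' \<theta>' x)" for K' t' \<theta>'
          by (rule R.integrable_const_bound[of _ 1])
             (use prod_indicator_bounds[where J=J and A=A] in \<open>auto simp: abs_mult intro!: mult_le_one AE_I2\<close>)
        have "(\<integral>y. cos (\<tau> * y + \<phi>) \<partial>?m R K t \<theta>) = (\<integral>x. ?W K t \<theta> x * cos (\<tau> * x j + \<phi>) \<partial>R)"
          using R by (rule transfer) measurable
        also have "\<dots> = (\<integral>x. ?ind J A x * ?L {j} (\<lambda>_. \<tau>) \<phi> x +
            (?ind J A x * ?L K1 t1 (\<theta> + \<phi>) x + ?ind J A x * ?L K2 t2 (\<theta> - \<phi>) x) / 2 \<partial>R)"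
          by (subst trig) (simp add: 1 2)
        also have "\<dots> = (\<integral>x. ?ind J A x * ?L {j} (\<lambda>_. \<tau>) \<phi> x \<partial>R) +
         ((\<integral>x. ?ind J A x * ?L K1 t1 (\<theta> + \<phi>) x \<partial>R) + (\<integral>x. ?ind J A x * ?L K2 t2 (\<theta> - \<phi>) x \<partial>R)) / 2"
          by (simp only: Bochner_Integration.integral_add Bochner_Integration.integrable_add
              integral_divide_zero integrable_divide_zero int simp_thms)
        finally show ?thesis .
      qed
      show "(\<integral>y. cos (\<tau> * y + \<phi>) \<partial>?m P K t \<theta>) = (\<integral>y. cos (\<tau> * y + \<phi>) \<partial>?m Q K t \<theta>)"
        using insert.IH[OF A 1(1)] insert.IH[OF A 2(1)] insert.IH[OF A, of "{j}"]
        by (simp only: expand[OF assms(1) sets(1)] expand[OF assms(2) sets(2)]) simp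
    qed auto
    have weighted: "(\<integral>x. indicator (A j) (x j) * ?W K' t' \<theta>' x \<partial>P) = (\<integral>x. indicator (A j) (x j) * ?W K' t' \<theta>' x \<partial>Q)"
      if "finite K'" for K' t' \<theta>'
    proof -
      have "(\<integral>y. indicator (A j) y \<partial>?m P K' t' \<theta>') = (\<integral>y. indicator (A j) y \<partial>?m Q K' t' \<theta>')"
        unfolding meq[OF that] ..
      then show ?thesis
        by (subst (asm) (1 2) transfer) (auto simp: sets mult.commute)
    qed
    have split: "(\<integral>x. indicator (A j) (x j) * ?W K t \<theta> x \<partial>R) =
        (\<integral>x. ?ind (insert j J) A x \<partial>R) + (\<integral>x. ?ind (insert j J) A x * ?L K t \<theta> x \<partial>R)"
      if "prob_space R" and R[measurable_cong]: "sets R = sets (PiM UNIV (\<lambda>_. borel))" for R K t \<theta>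
    proof -
      interpret R: prob_space R by fact
      have [measurable]: "?ind J A \<in> borel_measurable R"
        by (measurable; simp add: A)
      then have [measurable]: "?ind (insert j J) A \<in> borel_measurable R"
        by (simp add: insert.hyps)
      have "integrable R (?ind (insert j J) A)" 
        by (rule R.integrable_const_bound[of _ 1]) (use prod_indicator_bounds[where J="insert j J" and A=A] in auto)
      moreover have "integrable R (\<lambda>x. ?ind (insert j J) A x * ?L K t \<theta> x)"
        by (rule R.integrable_const_bound[of _ 1])
           (use prod_indicator_bounds[where J="insert j J" and A=A] in \<open>auto simp only: abs_mult real_norm_def intro!: mult_le_one AE_I2, auto\<close>)
      ultimately show ?thesis
        using insert.hyps
        by (subst Bochner_Integration.integral_add[symmetric]) (auto simp: algebra_simps)
    qed
    \<comment> \<open>The empty combination with phase \<open>0\<close> has weight \<open>2 * f\<close>, which isolates the summand without cosine.\<close>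
    have "(\<integral>x. indicator (A j) (x j) * ?W {} (\<lambda>_. 0) 0 x \<partial>P) = (\<integral>x. indicator (A j) (x j) * ?W {} (\<lambda>_. 0) 0 x \<partial>Q)"
      by (rule weighted) simp
    then have "2 * (\<integral>x. ?ind (insert j J) A x \<partial>P) = 2 * (\<integral>x. ?ind (insert j J) A x \<partial>Q)"
      unfolding split[OF assms(1) sets(1)] split[OF assms(2) sets(2)] by simp
    then show ?case
      using weighted[OF insert.prems(2)] unfolding split[OF assms(1) sets(1)] split[OF assms(2) sets(2)] 
      by simp
  qed
  show ?thesis
  proof (rule measure_eqI_PiM_infinite[OF sets])
    fix A :: "'i \<Rightarrow> real set" and J :: "'i set"
    assume J: "finite J" and A: "\<And>i. i \<in> J \<Longrightarrow> A i \<in> sets borel"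
    let ?E = "prod_emb UNIV (\<lambda>_. borel :: real measure) J (Pi\<^sub>E J A)"
    have E: "?E = {x. \<forall>j\<in>J. x j \<in> A j}"
      by (auto simp: prod_emb_def space_PiM PiE_iff)
    have "?E \<in> sets (PiM UNIV (\<lambda>_. borel))"
      using J A by (intro sets_PiM_I) auto
    moreover have "indicator ?E x = ?ind J A x" for x
      using J by (auto simp: E indicator_def)
    moreover have "(\<integral>x. ?ind J A x * cos ((\<Sum>k\<in>{}. 0 * x k) + 0) \<partial>P) =
        (\<integral>x. ?ind J A x * cos ((\<Sum>k\<in>{}. 0 * x k) + 0) \<partial>Q)"
      using J A by (intro main) auto
    ultimately have "(\<integral>x. indicator ?E x \<partial>P) = (\<integral>x. indicator ?E x \<partial>Q :: real)"
      by (simp del: Bochner_Integration.integral_indicator)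
    then have "measure P ?E = measure Q ?E"
      using \<open>?E \<in> _\<close> sets by simp
    then show "emeasure P ?E = emeasure Q ?E"
      by (simp add: P.emeasure_eq_measure Q.emeasure_eq_measure)
  qed (rule P.finite_measure_axioms)
qed

section \<open>Gaussian scale mixtures of Laplace type\<close>

abbreviation std_normal_sequence :: "(nat \<Rightarrow> real) measure" where
  "std_normal_sequence \<equiv> PiM UNIV (\<lambda>_. std_normal_distribution)"

interpretation std_normal_sequence: sequence_space std_normal_distribution
proof -
  interpret prob_space std_normal_distribution
    using real_dist_normal_dist by (simp add: real_distribution_def)
  show "sequence_space std_normal_distribution" by standard
qed

lemma sets_std_normal_sequence[measurable_cong]:
  "sets std_normal_sequence = sets (PiM UNIV (\<lambda>_. borel))"
  by (intro sets_PiM_cong) auto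

lemma std_normal_sequence_cos_transform:
  assumes "finite K"
  shows "(\<integral>g. cos ((\<Sum>k\<in>K. a k * g k) + \<theta>) \<partial>std_normal_sequence) = exp (- (\<Sum>k\<in>K. (a k)\<^sup>2) / 2) * cos \<theta>"
proof -
  let ?S = std_normal_sequence
  have component: "distr ?S borel (\<lambda>g. g k) = std_normal_distribution" for k
    using std_normal_sequence.PiM_component[of k] by (simp cong: distr_cong)
  have "distr ?S (PiM UNIV (\<lambda>_. borel)) (\<lambda>g. \<lambda>i\<in>UNIV. g i) = ?S"
    by (simp add: restrict_def distr_id2 sets_std_normal_sequence)
  then have "std_normal_sequence.P.indep_vars (\<lambda>_. borel) (\<lambda>k g. g k) UNIV"
    by (subst std_normal_sequence.P.indep_vars_iff_distr_eq_PiM) (simp_all add: component)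
  then have "std_normal_sequence.P.indep_vars (\<lambda>_. borel) (\<lambda>k g. a k * g k) UNIV"
    by (rule std_normal_sequence.P.indep_vars_compose2) auto
  then have indep: "std_normal_sequence.P.indep_vars (\<lambda>_. borel) (\<lambda>k g. a k * g k) K"
    by (rule std_normal_sequence.P.indep_vars_subset) auto
  have "char (distr ?S borel (\<lambda>g. a k * g k)) 1 = complex_of_real (exp (- (a k)\<^sup>2 / 2))" for k
  proof -
    have "char (distr ?S borel (\<lambda>g. a k * g k)) 1 = char (distr ?S borel (\<lambda>g. g k)) (a k)"
      by (simp add: char_def integral_distr)
    then show ?thesis by (simp add: component char_std_normal_distribution)
  qed
  then have "char (distr ?S borel (\<lambda>g. \<Sum>k\<in>K. a k * g k)) 1 = complex_of_real (\<Prod>k\<in>K. exp (- (a k)\<^sup>2 / 2))"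
    by (subst std_normal_sequence.P.char_distr_sum[OF indep]) simp
  also have "(\<Prod>k\<in>K. exp (- (a k)\<^sup>2 / 2)) = exp (- (\<Sum>k\<in>K. (a k)\<^sup>2) / 2)"
    by (simp add: exp_sum[OF assms, symmetric] sum_negf sum_divide_distrib)
  also have "char (distr ?S borel (\<lambda>g. \<Sum>k\<in>K. a k * g k)) 1 = (CLINT g|?S. iexp (\<Sum>k\<in>K. a k * g k))"
    by (simp add: char_def integral_distr del: of_real_sum)
  finally have E: "(CLINT g|?S. iexp (\<Sum>k\<in>K. a k * g k)) = complex_of_real (exp (- (\<Sum>k\<in>K. (a k)\<^sup>2) / 2))" .
  have I: "integrable ?S (\<lambda>g. iexp (\<Sum>k\<in>K. a k * g k))"
    by (rule std_normal_sequence.P.integrable_iexp) auto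
  have J: "integrable ?S (\<lambda>g. cos (\<Sum>k\<in>K. a k * g k))" "integrable ?S (\<lambda>g. sin (\<Sum>k\<in>K. a k * g k))"
    by (auto intro!: std_normal_sequence.P.integrable_const_bound[of _ 1])
  have "(\<integral>g. cos (\<Sum>k\<in>K. a k * g k) \<partial>?S) = exp (- (\<Sum>k\<in>K. (a k)\<^sup>2) / 2)"
    using arg_cong[OF E, of Re] integral_Re[OF I] by (simp add: Re_exp del: of_real_sum)
  moreover have "(\<integral>g. sin (\<Sum>k\<in>K. a k * g k) \<partial>?S) = 0"
    using arg_cong[OF E, of Im] integral_Im[OF I] by (simp add: Im_exp del: of_real_sum)
  ultimately show ?thesis
    using J by (simp add: cos_add)
qed

lemma AE_std_normal_shift:
  assumes [measurable]: "Measurable.pred borel P" and "AE x in std_normal_distribution. P x"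
  shows "AE x in std_normal_distribution. P (x + c)"
proof -
  have iff: "(AE x in std_normal_distribution. Q x) \<longleftrightarrow> (AE x in lborel. Q x)" for Q :: "real \<Rightarrow> bool"
    by (subst AE_density) (auto simp: normal_density_pos)
  show ?thesis
    using AE_borel_affine[of 1 P c] assms unfolding iff by (simp add: add.commute)
qed

text \<open>
  One coordinate of the product can be split off as an independent standard normal variable, and
  the normal distribution has the same null sets as Lebesgue measure, which is translation
  invariant. Fubini's theorem is used in the order that integrates the shifted coordinate first.
\<close>

lemma AE_std_normal_sequence_shift:
  assumes P[measurable]: "Measurable.pred (PiM UNIV (\<lambda>_. borel)) P"
    and "AE g in std_normal_sequence. P g"
  shows "AE g in std_normal_sequence. P (g(0 := g 0 + c))"
proof -
  let ?N = std_normal_distribution and ?S = std_normal_sequence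
  interpret N: prob_space ?N
    using real_dist_normal_dist by (simp add: real_distribution_def)
  interpret pair_sigma_finite ?N ?S ..
  have [measurable]: "(\<lambda>g. g(0 := g 0 + c)) \<in> measurable (PiM UNIV (\<lambda>_. borel)) (PiM UNIV (\<lambda>_. borel))"
    by (rule measurable_PiM_single') auto
  have [measurable]: "(\<lambda>x. case_nat (fst x) (snd x)) \<in> measurable (?N \<Otimes>\<^sub>M ?S) (PiM UNIV (\<lambda>_. borel))"
    by (rule measurable_PiM_single') (auto simp: split: nat.split)
  have split: "(AE g in ?S. Q g) \<longleftrightarrow> (AE g in ?S. AE x in ?N. Q (case_nat x g))"
    if [measurable]: "Measurable.pred (PiM UNIV (\<lambda>_. borel)) Q" for Q
  proof -
    have "(AE g in ?S. Q g) \<longleftrightarrow> (AE g in distr (?N \<Otimes>\<^sub>M ?S) ?S (\<lambda>(s, \<omega>). case_nat s \<omega>). Q g)"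
      by (subst std_normal_sequence.PiM_iter) rule
    also have "\<dots> \<longleftrightarrow> (AE x in ?N \<Otimes>\<^sub>M ?S. Q (case_nat (fst x) (snd x)))"
      by (subst AE_distr_iff) (auto simp: case_prod_beta)
    also have "\<dots> \<longleftrightarrow> (AE x in ?N. AE g in ?S. Q (case_nat x g))"
      by (rule AE_pair_iff[symmetric]) measurable
    also have "\<dots> \<longleftrightarrow> (AE g in ?S. AE x in ?N. Q (case_nat x g))"
      by (rule AE_commute) measurable
    finally show ?thesis .
  qed
  have "AE g in ?S. AE x in ?N. P (case_nat x g)"
    using assms(2) by (simp add: split)
  then have "AE g in ?S. AE x in ?N. P (case_nat (x + c) g)"
  proof eventually_elim
    fix g assume "AE x in ?N. P (case_nat x g)"
    moreover have "(\<lambda>x. case_nat x g) \<in> measurable borel (PiM UNIV (\<lambda>_. borel))"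
      by (rule measurable_PiM_single') (auto split: nat.split)
    then have "Measurable.pred borel (\<lambda>x. P (case_nat x g))"
      by measurable
    ultimately show "AE x in ?N. P (case_nat (x + c) g)"
      using AE_std_normal_shift[of "\<lambda>x. P (case_nat x g)" c] by simp
  qed
  moreover have "case_nat (x + c) g = (case_nat x g)(0 := case_nat x g 0 + c)" for x and g :: "nat \<Rightarrow> real"
    by (auto simp: fun_eq_iff split: nat.split)
  moreover have "Measurable.pred (PiM UNIV (\<lambda>_. borel)) (\<lambda>g. P (g(0 := g 0 + c)))"
    by measurable
  ultimately show ?thesis using split[of "\<lambda>g. P (g(0 := g 0 + c))"] by simp
qed

text \<open>
  A Gaussian scale mixture: an independent standard normal sequence multiplied by the square root
  of one exponential variable common to all coordinates. The factors \<open>\<sigma> k\<close> will be \<open>0\<close> or \<open>1\<close>; a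
  zero suppresses a coordinate.
\<close>

definition laplace_sequence :: "(nat \<Rightarrow> real) \<Rightarrow> (nat \<Rightarrow> real) measure" where
  "laplace_sequence \<sigma> = distr (density lborel (exponential_density 1) \<Otimes>\<^sub>M std_normal_sequence)
     (PiM UNIV (\<lambda>_. borel)) (\<lambda>(s, g) k. sqrt s * (\<sigma> k * g k))"

lemma measurable_laplace_sequence[measurable]:
  "(\<lambda>(s, g) k. sqrt s * (\<sigma> k * g k)) \<in>
    measurable (density lborel (exponential_density 1) \<Otimes>\<^sub>M std_normal_sequence) (PiM UNIV (\<lambda>_. borel))"
  by (rule measurable_PiM_single') (auto simp: case_prod_beta)

lemma sets_laplace_sequence[measurable_cong]: "sets (laplace_sequence \<sigma>) = sets (PiM UNIV (\<lambda>_. borel))"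
  by (simp add: laplace_sequence_def)

lemma prob_space_laplace_sequence: "prob_space (laplace_sequence \<sigma>)"
proof -
  interpret E: prob_space "density lborel (exponential_density 1)"
    by (rule prob_space_exponential_density) simp
  interpret pair_prob_space "density lborel (exponential_density 1)" std_normal_sequence ..
  show ?thesis
    unfolding laplace_sequence_def by (rule prob_space_distr) measurable
qed

lemma exponential_laplace_transform:
  assumes "q \<ge> 0"
  shows "(\<integral>s. exp (- s * q) \<partial>density lborel (exponential_density 1)) = 1 / (1 + q)"
proof -
  interpret E: prob_space "density lborel (exponential_density (1 + q))"
    using assms by (intro prob_space_exponential_density) simp
  have nonneg: "0 \<le> exponential_density (1 + q) x" "0 \<le> exponential_density 1 x" for x
    using assms by (auto intro!: exponential_density_nonneg)
  have "(\<integral>s. exp (- s * q) \<partial>density lborel (exponential_density 1)) =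
      (\<integral>s. exponential_density 1 s * exp (- s * q) \<partial>lborel)"
    using nonneg by (simp add: integral_density)
  also have "\<dots> = (\<integral>s. exponential_density (1 + q) s / (1 + q) \<partial>lborel)"
    using assms by (intro Bochner_Integration.integral_cong)
      (auto simp: exponential_density_def exp_add[symmetric] distrib_left mult.commute)
  also have "\<dots> = (\<integral>s. 1 \<partial>density lborel (exponential_density (1 + q))) / (1 + q)"
    using nonneg(1) by (subst integral_density) auto
  finally show ?thesis using E.prob_space by simp
qed

text \<open>
  Given the exponential variable \<open>s\<close>, the linear combination is centered normal with variance
  \<open>s * (\<Sum>k\<in>K. (\<sigma> k * t k)\<^sup>2)\<close>. Integrating \<open>exp (- s * q)\<close> against the exponential distribution
  produces the factor \<open>1 / (1 + q)\<close> that is characteristic of Laplace distributions.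
\<close>

lemma laplace_sequence_cos_transform:
  assumes K: "finite K"
  shows "(\<integral>x. cos ((\<Sum>k\<in>K. t k * x k) + \<theta>) \<partial>laplace_sequence \<sigma>) =
    cos \<theta> / (1 + (\<Sum>k\<in>K. (\<sigma> k * t k)\<^sup>2) / 2)"
proof -
  let ?E = "density lborel (exponential_density 1)"
  let ?S = std_normal_sequence
  let ?q = "(\<Sum>k\<in>K. (\<sigma> k * t k)\<^sup>2) / 2"
  interpret E: prob_space ?E
    by (rule prob_space_exponential_density) simp
  interpret pair_prob_space ?E ?S ..
  have [measurable]: "(\<lambda>x. \<Sum>k\<in>K. t k * (sqrt (fst x) * (\<sigma> k * snd x k))) \<in> borel_measurable (?E \<Otimes>\<^sub>M ?S)"
    by measurable
  have inner: "(\<integral>g. cos ((\<Sum>k\<in>K. t k * (sqrt s * (\<sigma> k * g k))) + \<theta>) \<partial>?S) = exp (- s * ?q) * cos \<theta>"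
    if "s \<ge> 0" for s
  proof -
    have "(\<integral>g. cos ((\<Sum>k\<in>K. t k * (sqrt s * (\<sigma> k * g k))) + \<theta>) \<partial>?S) =
        (\<integral>g. cos ((\<Sum>k\<in>K. (t k * sqrt s * \<sigma> k) * g k) + \<theta>) \<partial>?S)"
      by (simp add: mult.assoc)
    also have "\<dots> = exp (- (\<Sum>k\<in>K. (t k * sqrt s * \<sigma> k)\<^sup>2) / 2) * cos \<theta>"
      by (rule std_normal_sequence_cos_transform[OF K])
    also have "(\<Sum>k\<in>K. (t k * sqrt s * \<sigma> k)\<^sup>2) = s * (\<Sum>k\<in>K. (\<sigma> k * t k)\<^sup>2)"
      using that by (simp add: sum_distrib_left power_mult_distrib mult_ac)
    finally show ?thesis by simp
  qed
  have "(\<integral>x. cos ((\<Sum>k\<in>K. t k * x k) + \<theta>) \<partial>laplace_sequence \<sigma>) =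
      (\<integral>x. cos ((\<Sum>k\<in>K. t k * (sqrt (fst x) * (\<sigma> k * snd x k))) + \<theta>) \<partial>(?E \<Otimes>\<^sub>M ?S))"
    unfolding laplace_sequence_def by (subst integral_distr) (auto simp: case_prod_beta)
  also have "\<dots> = (\<integral>s. \<integral>g. cos ((\<Sum>k\<in>K. t k * (sqrt s * (\<sigma> k * g k))) + \<theta>) \<partial>?S \<partial>?E)"
    by (subst integral_fst'[symmetric]) (auto intro!: integrable_const_bound[of _ 1])
  also have "\<dots> = (\<integral>s. exp (- s * ?q) * cos \<theta> \<partial>?E)"
  proof (rule integral_cong_AE)
    show "AE s in ?E. (\<integral>g. cos ((\<Sum>k\<in>K. t k * (sqrt s * (\<sigma> k * g k))) + \<theta>) \<partial>?S) = exp (- s * ?q) * cos \<theta>"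
      by (subst AE_density) (auto simp: exponential_density_def inner intro!: AE_I2)
  qed measurable
  also have "\<dots> = 1 / (1 + ?q) * cos \<theta>"
    by (subst integral_mult_left_zero, subst exponential_laplace_transform) (auto intro!: sum_nonneg)
  finally show ?thesis by simp
qed

text \<open>
  Given \<open>s > 0\<close>, a shift of coordinate \<open>0\<close> by \<open>c\<close> is a shift of the underlying normal variable by
  \<open>c / sqrt s\<close>, so quasi-invariance is inherited from the normal sequence.
\<close>

lemma AE_laplace_sequence_shift:
  assumes [measurable]: "Measurable.pred (PiM UNIV (\<lambda>_. borel)) P"
    and "AE x in laplace_sequence \<sigma>. P x" and "\<sigma> 0 = 1"
  shows "AE x in laplace_sequence \<sigma>. P (x(0 := x 0 + c))"
proof -
  let ?E = "density lborel (exponential_density 1)"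
  let ?S = std_normal_sequence
  let ?X = "\<lambda>s (g :: nat \<Rightarrow> real) k. sqrt s * (\<sigma> k * g k)"
  interpret E: prob_space ?E
    by (rule prob_space_exponential_density) simp
  interpret pair_prob_space ?E ?S ..
  have [measurable]: "(\<lambda>g. g(0 := g 0 + c)) \<in> measurable (PiM UNIV (\<lambda>_. borel)) (PiM UNIV (\<lambda>_. borel))"
    by (rule measurable_PiM_single') auto
  have iff: "(AE x in laplace_sequence \<sigma>. Q x) \<longleftrightarrow> (AE s in ?E. AE g in ?S. Q (?X s g))"
    if [measurable]: "Measurable.pred (PiM UNIV (\<lambda>_. borel)) Q" for Q
  proof -
    have "(AE x in laplace_sequence \<sigma>. Q x) \<longleftrightarrow> (AE z in ?E \<Otimes>\<^sub>M ?S. Q (case z of (s, g) \<Rightarrow> ?X s g))"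
      unfolding laplace_sequence_def by (subst AE_distr_iff) auto
    also have "\<dots> \<longleftrightarrow> (AE z in ?E \<Otimes>\<^sub>M ?S. Q (?X (fst z) (snd z)))"
      by (simp add: case_prod_beta)
    also have "\<dots> \<longleftrightarrow> (AE s in ?E. AE g in ?S. Q (?X s g))"
    proof (rule AE_pair_iff[symmetric])
      have [measurable]: "(\<lambda>z. ?X (fst z) (snd z)) \<in> measurable (?E \<Otimes>\<^sub>M ?S) (PiM UNIV (\<lambda>_. borel))"
        using measurable_laplace_sequence[of \<sigma>] by (simp add: case_prod_beta)
      show "{z \<in> space (?E \<Otimes>\<^sub>M ?S). Q (?X (fst z) (snd z))} \<in> sets (?E \<Otimes>\<^sub>M ?S)"
        by measurable
    qed
    finally show ?thesis .
  qed
  have "AE s in ?E. s > 0"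
    using AE_lborel_singleton[of "0::real"]
    by (subst AE_density) (auto simp: exponential_density_def elim!: eventually_mono)
  moreover have "AE s in ?E. AE g in ?S. P (?X s g)"
    using assms(2) by (simp add: iff)
  ultimately have "AE s in ?E. AE g in ?S. P ((?X s g)(0 := ?X s g 0 + c))"
  proof eventually_elim
    fix s :: real assume s: "s > 0" and "AE g in ?S. P (?X s g)"
    moreover have "(\<lambda>g. ?X s g) \<in> measurable (PiM UNIV (\<lambda>_. borel)) (PiM UNIV (\<lambda>_. borel))"
      by (rule measurable_PiM_single') auto
    then have "Measurable.pred (PiM UNIV (\<lambda>_. borel)) (\<lambda>g. P (?X s g))"
      by measurable
    ultimately have "AE g in ?S. P (?X s (g(0 := g 0 + c / sqrt s)))"
      by (intro AE_std_normal_sequence_shift)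
    moreover have "?X s (g(0 := g 0 + c / sqrt s)) = (?X s g)(0 := ?X s g 0 + c)" for g
      using s assms(3) by (auto simp: fun_eq_iff field_simps)
    ultimately show "AE g in ?S. P ((?X s g)(0 := ?X s g 0 + c))" by simp
  qed
  then show ?thesis by (subst iff) simp_all
qed

section \<open>Orthogonality and density in Hilbert space\<close>

text \<open>
  The closest point to \<open>y\<close> in the closure of \<open>R\<close> exists by the parallelogram identity and
  completeness, and the difference to \<open>y\<close> is orthogonal to \<open>R\<close>.
\<close>

lemma dense_subspace_if_orthogonal_complement_trivial:
  fixes R :: "'a::{real_inner, complete_space} set"
  assumes R: "subspace R" and orth: "\<And>z. (\<And>t. t \<in> R \<Longrightarrow> inner z t = 0) \<Longrightarrow> z = 0"
  shows "closure R = UNIV"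
proof -
  have "y \<in> closure R" for y
  proof -
    define \<delta> where "\<delta> = infdist y R"
    have "R \<noteq> {}" using R subspace_0 by blast
    have lower: "\<delta> \<le> norm (y - t)" if "t \<in> R" for t
      using infdist_le[OF that, of y] by (simp add: \<delta>_def dist_norm)
    have \<delta>: "\<delta> \<ge> 0" by (simp add: \<delta>_def infdist_nonneg)
    have "\<exists>t\<in>R. norm (y - t) < \<delta> + 1 / real (Suc n)" for n
    proof -
      have "(INF t\<in>R. dist y t) < \<delta> + 1 / real (Suc n)"
        using \<open>R \<noteq> {}\<close> by (simp add: \<delta>_def infdist_notempty)
      then show ?thesis
        using \<open>R \<noteq> {}\<close> by (subst (asm) cINF_less_iff) (auto simp: dist_norm intro: bdd_belowI2[of _ 0])
    qed
    then obtain s where s: "\<And>n. s n \<in> R" "\<And>n. norm (y - s n) < \<delta> + 1 / real (Suc n)"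
      by metis
    have lim: "(\<lambda>n. norm (y - s n)) \<longlonglongrightarrow> \<delta>"
    proof (rule tendsto_sandwich[OF _ _ tendsto_const])
      show "\<forall>\<^sub>F n in sequentially. \<delta> \<le> norm (y - s n)"
        using lower s(1) by simp
      show "\<forall>\<^sub>F n in sequentially. norm (y - s n) \<le> \<delta> + 1 / real (Suc n)"
        using less_imp_le[OF s(2)] by (intro always_eventually allI)
      show "(\<lambda>n. \<delta> + 1 / real (Suc n)) \<longlonglongrightarrow> \<delta>"
        using tendsto_add[OF tendsto_const[of \<delta>] LIMSEQ_Suc[OF lim_1_over_n[where 'a = real]]] by simp
    qed
    then have lim2: "(\<lambda>n. (norm (y - s n))\<^sup>2) \<longlonglongrightarrow> \<delta>\<^sup>2" by (intro tendsto_intros)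
    have "Cauchy s"
    proof (rule metric_CauchyI)
      fix e :: real assume e: "e > 0"
      from order_tendstoD(2)[OF lim2, of "\<delta>\<^sup>2 + e\<^sup>2 / 4"] e
      obtain N where N: "\<And>n. n \<ge> N \<Longrightarrow> (norm (y - s n))\<^sup>2 < \<delta>\<^sup>2 + e\<^sup>2 / 4"
        by (auto simp: eventually_sequentially)
      have "dist (s m) (s n) < e" if "m \<ge> N" "n \<ge> N" for m n
      proof -
        let ?mid = "(1 / 2) *\<^sub>R (s m + s n)"
        have "?mid \<in> R" using R s by (intro subspace_scale subspace_add)
        then have "\<delta>\<^sup>2 \<le> (norm (y - ?mid))\<^sup>2" using lower \<delta> by (intro power_mono) auto
        moreover have "(norm (s m - s n))\<^sup>2 = 2 * (norm (y - s m))\<^sup>2 + 2 * (norm (y - s n))\<^sup>2 - 4 * (norm (y - ?mid))\<^sup>2"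
          by (simp add: power2_norm_eq_inner inner_diff_left inner_diff_right inner_add_left inner_add_right
              inner_commute algebra_simps)
        ultimately have "(norm (s m - s n))\<^sup>2 < e\<^sup>2"
          using N[OF that(1)] N[OF that(2)] by simp
        then show ?thesis using e by (simp add: dist_norm power_less_imp_less_base)
      qed
      then show "\<exists>M. \<forall>m\<ge>M. \<forall>n\<ge>M. dist (s m) (s n) < e" by blast
    qed
    then obtain l where l: "s \<longlonglongrightarrow> l"
      using Cauchy_convergent_iff convergent_def by blast
    define z where "z = y - l"
    have "norm z = \<delta>"
      using tendsto_norm[OF tendsto_diff[OF tendsto_const[of y] l]] lim LIMSEQ_unique
      by (auto simp: z_def)
    have "inner z t = 0" if t: "t \<in> R" for t
    proof (cases "t = 0")
      case False
      \<comment> \<open>This \<open>c\<close> minimizes \<open>norm (z - c *\<^sub>R t)\<close>.\<close>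
      define c where "c = inner z t / (norm t)\<^sup>2"
      have "(\<lambda>n. norm (y - (s n + c *\<^sub>R t))) \<longlonglongrightarrow> norm (y - (l + c *\<^sub>R t))"
        by (intro tendsto_intros l)
      moreover have "\<delta> \<le> norm (y - (s n + c *\<^sub>R t))" for n
        using R s t by (intro lower subspace_add subspace_scale) auto
      ultimately have "\<delta> \<le> norm (y - (l + c *\<^sub>R t))"
        using LIMSEQ_le_const by blast
      then have "(norm z)\<^sup>2 \<le> (norm (z - c *\<^sub>R t))\<^sup>2"
        using \<open>norm z = \<delta>\<close> by (intro power_mono) (auto simp: z_def algebra_simps)
      also have "\<dots> = (norm z)\<^sup>2 - 2 * c * inner z t + c\<^sup>2 * (norm t)\<^sup>2"
        by (simp add: power2_norm_eq_inner inner_diff_left inner_diff_right inner_commute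
            power2_eq_square[of c] algebra_simps)
      also have "\<dots> = (norm z)\<^sup>2 - (inner z t)\<^sup>2 / (norm t)\<^sup>2"
        using False by (simp add: c_def field_simps power2_eq_square)
      finally have "(inner z t)\<^sup>2 / (norm t)\<^sup>2 \<le> 0" by simp
      then show ?thesis using False by (simp add: divide_le_0_iff)
    qed simp
    then have "z = 0" by (rule orth)
    then have "s \<longlonglongrightarrow> y" using l by (simp add: z_def)
    then show ?thesis using s closure_sequential by blast
  qed
  then show ?thesis by auto
qed

text \<open>
  This writes a closed ball as a countable intersection of cylinder sets, each of which constrains a
  single continuous linear functional.
\<close>

lemma norm_le_iff_inner_dense:
  fixes d :: "nat \<Rightarrow> 'a::real_inner"
  assumes dense: "closure (range d) = UNIV" and r: "r \<ge> 0"
  shows "norm y \<le> r \<longleftrightarrow> (\<forall>k. \<bar>inner y (d k)\<bar> \<le> r * norm (d k))"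
proof
  assume "norm y \<le> r"
  then show "\<forall>k. \<bar>inner y (d k)\<bar> \<le> r * norm (d k)"
    using Cauchy_Schwarz_ineq2 order_trans mult_right_mono norm_ge_zero by metis
next
  assume bound: "\<forall>k. \<bar>inner y (d k)\<bar> \<le> r * norm (d k)"
  have "closed {x. \<bar>inner y x\<bar> \<le> r * norm x}"
    by (intro closed_Collect_le continuous_intros)
  then have "closure (range d) \<subseteq> {x. \<bar>inner y x\<bar> \<le> r * norm x}"
    using bound by (intro closure_minimal) auto
  then have "norm y * norm y \<le> r * norm y"
    using dense by (auto simp: dot_square_norm power2_eq_square dest!: subsetD[where c = y])
  then show "norm y \<le> r"
    using r by (cases "norm y = 0") auto
qed

locale positive_definite_operator =
  fixes C :: "'a::real_inner \<Rightarrow> 'a"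
  assumes linear: "linear C"
    and symmetric: "inner (C x) y = inner (C y) x"
    and positive: "x \<noteq> 0 \<Longrightarrow> inner (C x) x > 0"
begin

text \<open>
  Orthonormalization with respect to the form \<open>inner (C x) y\<close>. The sequence \<open>d\<close> may be linearly
  dependent: where \<open>d n\<close> is a combination of its predecessors, division by zero yields the vector
  \<open>0\<close>. The form then takes the value \<open>0\<close> instead of \<open>1\<close> on the diagonal.
\<close>

fun gram_schmidt :: "(nat \<Rightarrow> 'a) \<Rightarrow> nat \<Rightarrow> 'a" where
  "gram_schmidt d n =
    (let r = d n - (\<Sum>j<n. inner (C (d n)) (gram_schmidt d j) *\<^sub>R gram_schmidt d j)
     in r /\<^sub>R sqrt (inner (C r) r))"

declare gram_schmidt.simps[simp del]

lemma inner_C_simps: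
  "inner (C (x + y)) z = inner (C x) z + inner (C y) z"
  "inner (C (x - y)) z = inner (C x) z - inner (C y) z"
  "inner (C (a *\<^sub>R x)) z = a * inner (C x) z"
  "inner (C (sum f A)) z = (\<Sum>i\<in>A. inner (C (f i)) z)"
  using linear by (simp_all add: linear_add linear_diff linear_scale linear_sum inner_simps inner_sum_left)

lemma C_zero[simp]: "C 0 = 0"
  using linear by (rule linear_0)

definition residual :: "(nat \<Rightarrow> 'a) \<Rightarrow> nat \<Rightarrow> 'a" where
  "residual d n = d n - (\<Sum>j<n. inner (C (d n)) (gram_schmidt d j) *\<^sub>R gram_schmidt d j)"

lemma gram_schmidt_residual:
  "gram_schmidt d n = residual d n /\<^sub>R sqrt (inner (C (residual d n)) (residual d n))"
  by (subst gram_schmidt.simps) (simp add: residual_def Let_def)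

lemma gram_schmidt_normalized:
  "inner (C (gram_schmidt d n)) (gram_schmidt d n) = of_bool (gram_schmidt d n \<noteq> 0)"
proof (cases "residual d n = 0")
  case False
  then show ?thesis
    using positive[OF False] by (simp add: gram_schmidt_residual inner_C_simps field_simps flip: power2_eq_square)
qed (simp add: gram_schmidt_residual)

lemma gram_schmidt_orthogonal_less:
  "i < n \<Longrightarrow> inner (C (gram_schmidt d n)) (gram_schmidt d i) = 0"
proof (induction n arbitrary: i rule: less_induct)
  case (less n)
  let ?u = "gram_schmidt d"
  have orth: "inner (C (?u j)) (?u i) = (if j = i then of_bool (?u i \<noteq> 0) else 0)" if "j < n" for j
    using less.IH[of j i] less.IH[of i j] less.prems that symmetric[of "?u i" "?u j"] gram_schmidt_normalized[of d i]
    by (cases j i rule: linorder_cases) auto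
  have "inner (C (residual d n)) (?u i) = inner (C (d n)) (?u i) -
      (\<Sum>j<n. inner (C (d n)) (?u j) * (if j = i then of_bool (?u i \<noteq> 0) else 0))"
    by (simp add: residual_def inner_C_simps orth)
  also have "\<dots> = 0"
    using less.prems by (cases "?u i = 0") (simp_all add: if_distrib[of "(*) _"] cong: if_cong)
  finally show ?case by (simp add: gram_schmidt_residual[of d n] inner_C_simps)
qed

lemma gram_schmidt_orthonormal:
  "inner (C (gram_schmidt d i)) (gram_schmidt d j) = (if i = j then of_bool (gram_schmidt d i \<noteq> 0) else 0)"
  using gram_schmidt_orthogonal_less[of i j d] gram_schmidt_orthogonal_less[of j i d]
    symmetric[of "gram_schmidt d i" "gram_schmidt d j"] gram_schmidt_normalized[of d i]
  by (cases i j rule: linorder_cases) auto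

lemma gram_schmidt_expansion:
  "d n = (\<Sum>j\<le>n. inner (C (d n)) (gram_schmidt d j) *\<^sub>R gram_schmidt d j)"
proof -
  let ?u = "gram_schmidt d" and ?r = "residual d n"
  let ?c = "sqrt (inner (C ?r) ?r)"
  have d: "d n = ?r + (\<Sum>j<n. inner (C (d n)) (?u j) *\<^sub>R ?u j)"
    by (simp add: residual_def)
  have "inner (C (d n)) (?u n) *\<^sub>R ?u n = ?r"
  proof (cases "?r = 0")
    case False
    have c: "?c > 0" using positive[OF False] by simp
    have "inner (C (d n)) (?u n) = inner (C ?r) (?u n) + (\<Sum>j<n. inner (C (d n)) (?u j) * inner (C (?u j)) (?u n))"
      by (subst d) (simp add: inner_C_simps)
    also have "\<dots> = inner (C ?r) (?u n)"
      by (simp add: gram_schmidt_orthonormal)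
    also have "\<dots> = ?c"
      using c by (subst gram_schmidt_residual) (simp add: field_simps)
    finally show ?thesis using c by (simp add: gram_schmidt_residual)
  qed (simp add: gram_schmidt_residual)
  then show ?thesis using d by (simp add: lessThan_Suc_atMost[symmetric] add.commute)
qed

lemma orthogonal_range_imp_zero:
  "(\<And>t. t \<in> range C \<Longrightarrow> inner z t = 0) \<Longrightarrow> z = 0"
  using positive[of z] by (metis inner_commute less_irrefl rangeI)

end

section \<open>Centered Laplace measures\<close>

locale centered_laplace_measure =
  fixes \<nu> :: "'a::{real_inner, polish_space} measure" and C :: "'a \<Rightarrow> 'a"
  assumes laplace: "laplace_measure \<nu>"
    and mean_zero: "is_mean \<nu> 0"
    and covariance: "is_covariance_operator \<nu> 0 C"
begin

sublocale prob_space \<nu>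
  using laplace by (simp add: laplace_measure_def)

lemma sets_\<nu>[measurable_cong]: "sets \<nu> = sets borel"
  using laplace by (simp add: laplace_measure_def)

lemma space_\<nu>[simp]: "space \<nu> = UNIV"
  using sets_eq_imp_space_eq[OF sets_\<nu>] by simp

text \<open>
  A Laplace distribution is determined by its mean and variance, which for \<open>inner x\<close> are \<open>0\<close> and
  \<open>inner (C x) x\<close>.
\<close>

lemma marginal_distribution:
  assumes "x \<noteq> 0"
  obtains b where "b > 0" "inner (C x) x = 2 * b\<^sup>2"
    "distr \<nu> borel (inner x) = density lborel (\<lambda>s. ennreal (laplace_density 0 b s))"
proof -
  from laplace assms obtain m b where b: "b > 0" and
    cdf: "\<And>t. measure \<nu> {y. inner x y \<le> t} = cdf (density lborel (\<lambda>s. ennreal (laplace_density m b s))) t"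
    unfolding laplace_measure_def by blast
  let ?L = "\<lambda>m. density lborel (\<lambda>s. ennreal (laplace_density m b s))"
  have nonneg: "0 \<le> laplace_density m b s" for m s
    using b by (simp add: laplace_density_def)
  have [measurable]: "laplace_density m b \<in> borel_measurable borel" for m
    unfolding laplace_density_def[abs_def] by measurable
  have "prob_space (?L m)"
    using laplace_density_integral_1[OF b, of m] nonneg
    by (intro prob_spaceI) (simp add: emeasure_density nn_integral_eq_integral has_bochner_integral_iff)
  then have dist: "real_distribution (?L m)" 
    by (simp add: real_distribution_def real_distribution_axioms_def)
  have distr: "real_distribution (distr \<nu> borel (inner x))"
    by (simp add: real_distribution_def real_distribution_axioms_def prob_space_distr)
  have law: "distr \<nu> borel (inner x) = ?L m"
  proof (rule cdf_unique[OF distr dist])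
    show "cdf (distr \<nu> borel (inner x)) = cdf (?L m)"
      by (auto simp: fun_eq_iff cdf[symmetric] cdf_def[of "distr _ _ _"] measure_distr vimage_def)
  qed
  have int: "(\<integral>w. f (inner x w) \<partial>\<nu>) = (\<integral>s. laplace_density m b s * f s \<partial>lborel)"
    if [measurable]: "f \<in> borel_measurable borel" for f :: "real \<Rightarrow> real"
  proof -
    have "(\<integral>w. f (inner x w) \<partial>\<nu>) = (\<integral>s. f s \<partial>distr \<nu> borel (inner x))"
      by (simp add: integral_distr)
    then show ?thesis using nonneg by (simp add: law integral_density)
  qed
  have "m = 0"
  proof -
    have "0 = (\<integral>w. inner w x \<partial>\<nu>)"
      using mean_zero by (simp add: is_mean_def)
    also have "\<dots> = (\<integral>w. inner x w \<partial>\<nu>)"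
      by (rule Bochner_Integration.integral_cong) (simp_all add: inner_commute)
    also have "\<dots> = (\<integral>s. laplace_density m b s * s \<partial>lborel)"
      by (rule int) simp
    also have "\<dots> = m"
      using laplace_density_mean[OF b, of m] by (rule has_bochner_integral_integral_eq)
    finally show ?thesis ..
  qed
  have "inner (C x) x = (\<integral>w. (inner x w)\<^sup>2 \<partial>\<nu>)"
    using covariance by (simp add: is_covariance_operator_def power2_eq_square)
  also have "\<dots> = (\<integral>s. laplace_density m b s * s\<^sup>2 \<partial>lborel)"
    by (rule int) simp
  also have "\<dots> = 2 * b\<^sup>2"
    using laplace_density_second_moment[OF b] unfolding \<open>m = 0\<close> by (rule has_bochner_integral_integral_eq)
  finally show ?thesis using that b law \<open>m = 0\<close> by blast
qed

lemma covariance_eq: "inner (C x) y = (\<integral>w. inner x w * inner y w \<partial>\<nu>)"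
  and covariance_integrable: "integrable \<nu> (\<lambda>w. inner x w * inner y w)"
  using covariance by (simp_all add: is_covariance_operator_def)

text \<open>
  Positivity expresses that no marginal distribution is degenerate: its variance is \<open>2 * b\<^sup>2\<close>
  with \<open>b > 0\<close>.
\<close>

sublocale positive_definite_operator C
proof
  show "C (x + y) = C x + C y" for x y
  proof (rule vector_eq_rdot[THEN iffD1], rule allI)
    fix z show "inner (C (x + y)) z = inner (C x + C y) z"
      using covariance_integrable[of x z] covariance_integrable[of y z]
      by (simp add: inner_add_left covariance_eq algebra_simps)
  qed
  show "C (r *\<^sub>R x) = r *\<^sub>R C x" for r x
  proof (rule vector_eq_rdot[THEN iffD1], rule allI)
    fix z show "inner (C (r *\<^sub>R x)) z = inner (r *\<^sub>R C x) z"
      by (simp add: covariance_eq mult.assoc)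
  qed
  show "inner (C x) y = inner (C y) x" for x y
    by (simp add: covariance_eq mult.commute)
  show "inner (C x) x > 0" if "x \<noteq> 0" for x
    using marginal_distribution[OF that] by (metis zero_less_numeral zero_less_power mult_pos_pos)
qed

lemma cos_transform: "(\<integral>w. cos (inner x w + \<theta>) \<partial>\<nu>) = cos \<theta> / (1 + inner (C x) x / 2)"
proof (cases "x = 0")
  case True
  then show ?thesis using prob_space by simp
next
  case False
  then obtain b where b: "b > 0" "inner (C x) x = 2 * b\<^sup>2"
    and law: "distr \<nu> borel (inner x) = density lborel (\<lambda>s. ennreal (laplace_density 0 b s))"
    by (rule marginal_distribution)
  have [measurable]: "laplace_density m b \<in> borel_measurable borel" for m
    unfolding laplace_density_def[abs_def] by measurable
  have "(\<integral>w. cos (inner x w + \<theta>) \<partial>\<nu>) = (\<integral>s. cos (s + \<theta>) \<partial>distr \<nu> borel (inner x))"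
    by (simp add: integral_distr)
  also have "\<dots> = (\<integral>s. laplace_density 0 b s * cos (1 * s + \<theta>) \<partial>lborel)"
    unfolding law using b by (subst integral_density) (auto simp: laplace_density_def)
  also have "\<dots> = cos \<theta> / (1 + 1\<^sup>2 * b\<^sup>2)"
    using laplace_density_cos_transform[OF b(1)] by (rule has_bochner_integral_integral_eq)
  finally show ?thesis using b by simp
qed

text \<open>
  Linear combinations of the coordinates are values of one functional \<open>inner z\<close>, so the
  one-dimensional marginals determine the whole cosine transform. Uniqueness then identifies the
  joint law with the Gaussian scale mixture.
\<close>

lemma distr_orthonormal_coordinates:
  assumes orth: "\<And>i j. inner (C (u i)) (u j) = (if i = j then of_bool (u i \<noteq> 0) else 0)"
  shows "distr \<nu> (PiM UNIV (\<lambda>_. borel)) (\<lambda>w k. inner (u k) w) = laplace_sequence (\<lambda>k. of_bool (u k \<noteq> 0))"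
proof (rule measure_eqI_PiM_cos)
  have [measurable]: "(\<lambda>w k. inner (u k) w) \<in> measurable \<nu> (PiM UNIV (\<lambda>_. borel))"
    by (rule measurable_PiM_single') auto
  show "prob_space (distr \<nu> (PiM UNIV (\<lambda>_. borel)) (\<lambda>w k. inner (u k) w))"
    by (rule prob_space_distr) measurable
  fix K :: "nat set" and t :: "nat \<Rightarrow> real" and \<theta> :: real
  assume K: "finite K"
  let ?z = "\<Sum>k\<in>K. t k *\<^sub>R u k"
  have "inner (C ?z) ?z = (\<Sum>k\<in>K. (of_bool (u k \<noteq> 0) * t k)\<^sup>2)"
  proof -
    have "inner (C ?z) ?z = (\<Sum>i\<in>K. \<Sum>j\<in>K. t i * (t j * (if j = i then of_bool (u j \<noteq> 0) else 0)))"
      by (simp add: inner_C_simps inner_sum_right orth sum_distrib_left)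
    also have "\<dots> = (\<Sum>i\<in>K. (of_bool (u i \<noteq> 0) * t i)\<^sup>2)"
      using K by (intro sum.cong) (auto simp: power2_eq_square if_distrib[of "(*) _"] cong: if_cong)
    finally show ?thesis .
  qed
  then show "(\<integral>x. cos ((\<Sum>k\<in>K. t k * x k) + \<theta>) \<partial>distr \<nu> (PiM UNIV (\<lambda>_. borel)) (\<lambda>w k. inner (u k) w)) =
      (\<integral>x. cos ((\<Sum>k\<in>K. t k * x k) + \<theta>) \<partial>laplace_sequence (\<lambda>k. of_bool (u k \<noteq> 0)))"
    using cos_transform[of ?z \<theta>] K
    by (simp add: integral_distr laplace_sequence_cos_transform inner_sum_left)
qed (simp_all add: prob_space_laplace_sequence sets_laplace_sequence)

text \<open>
  Quasi-invariance under translations along the range of \<open>C\<close>, for closed balls. Orthonormalize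
  \<open>v\<close> followed by a dense sequence. The expansion of the dense sequence shows that membership in
  \<open>cball h r\<close> depends only on the coordinates \<open>inner (u k) w\<close>. Since \<open>inner (u k) (C v)\<close>
  vanishes for \<open>k > 0\<close>, translation by \<open>C v\<close> moves coordinate \<open>0\<close> only, and such shifts preserve null
  sets of the joint law.
\<close>

lemma cball_null_translate:
  assumes null: "emeasure \<nu> (cball h r) = 0" and r: "r \<ge> 0"
  shows "emeasure \<nu> (cball (h + C v) r) = 0"
proof (cases "v = 0")
  case False
  obtain D :: "'a set" where D: "countable D" "\<And>X. open X \<Longrightarrow> X \<noteq> {} \<Longrightarrow> \<exists>d\<in>D. d \<in> X"
    by (rule countable_dense_setE) blast
  have "D \<noteq> {}" using D(2)[of UNIV] by auto
  define d where "d = case_nat v (from_nat_into D)"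
  have "closure (range d) = UNIV"
  proof -
    have "D \<subseteq> range d"
    proof
      fix x assume "x \<in> D"
      then obtain n where "x = from_nat_into D n"
        using D(1) from_nat_into_surj by metis
      then have "x = d (Suc n)" by (simp add: d_def)
      then show "x \<in> range d" by blast
    qed
    moreover have "closure D = UNIV"
      using D(2) by (auto simp: closure_iff_nhds_not_empty) (metis Int_iff empty_iff subsetD)
    ultimately show ?thesis using closure_mono by blast
  qed
  note norm_le = norm_le_iff_inner_dense[OF this r]
  define u where "u = gram_schmidt d"
  define \<sigma> :: "nat \<Rightarrow> real" where "\<sigma> k = of_bool (u k \<noteq> 0)" for k
  let ?\<Phi> = "\<lambda>w k. inner (u k) w"
  have [measurable]: "?\<Phi> \<in> measurable \<nu> (PiM UNIV (\<lambda>_. borel))"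
    by (rule measurable_PiM_single') auto
  note orth = gram_schmidt_orthonormal[of d, folded u_def]
  note expand = gram_schmidt_expansion[of d, folded u_def]
  have law: "distr \<nu> (PiM UNIV (\<lambda>_. borel)) ?\<Phi> = laplace_sequence \<sigma>"
    unfolding \<sigma>_def using orth by (rule distr_orthonormal_coordinates)
  define a where "a = inner (C v) (u 0)"
  have v: "v = a *\<^sub>R u 0"
    using expand[of 0] by (simp add: d_def a_def)
  then have "\<sigma> 0 = 1" using False by (auto simp: \<sigma>_def)
  have translate: "?\<Phi> (w - C v) = (?\<Phi> w)(0 := ?\<Phi> w 0 + (- a))" for w
  proof
    fix k
    have "inner (u k) (C v) = (if k = 0 then a else 0)"
      using orth[of 0 k] \<open>\<sigma> 0 = 1\<close> 
      by (subst v) (auto simp: inner_commute[of "u k"] inner_C_simps \<sigma>_def)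
    then show "?\<Phi> (w - C v) k = ((?\<Phi> w)(0 := ?\<Phi> w 0 + (- a))) k"
      by (simp add: inner_diff_right)
  qed
  define P where "P x \<longleftrightarrow>
    \<not> (\<forall>k. \<bar>(\<Sum>j\<le>k. inner (C (d k)) (u j) * x j) - inner h (d k)\<bar> \<le> r * norm (d k))" for x
  have P_iff: "P (?\<Phi> w) \<longleftrightarrow> w \<notin> cball h r" for w
  proof -
    have "(\<Sum>j\<le>k. inner (C (d k)) (u j) * inner (u j) w) = inner (d k) w" for k
      by (subst (2) expand) (simp add: inner_sum_left)
    then show ?thesis
      using norm_le[of "w - h"] by (simp add: P_def dist_norm norm_minus_commute inner_diff_left inner_diff_right inner_commute)
  qed
  have [measurable]: "Measurable.pred (PiM UNIV (\<lambda>_. borel)) P"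
    unfolding P_def[abs_def] by measurable
  have [measurable]: "(\<lambda>x. x(0 := x 0 + (- a))) \<in> measurable (PiM UNIV (\<lambda>_. borel)) (PiM UNIV (\<lambda>_. borel))"
    by (rule measurable_PiM_single') auto
  have AE_law: "(AE x in laplace_sequence \<sigma>. Q x) \<longleftrightarrow> (AE w in \<nu>. Q (?\<Phi> w))"
    if [measurable]: "Measurable.pred (PiM UNIV (\<lambda>_. borel)) Q" for Q
    unfolding law[symmetric] by (rule AE_distr_iff) measurable
  have "AE w in \<nu>. w \<notin> cball h r"
    using null by (intro AE_not_in) (simp add: null_sets_def sets_\<nu>)
  then have "AE x in laplace_sequence \<sigma>. P x"
    by (simp add: AE_law P_iff)
  then have "AE x in laplace_sequence \<sigma>. P (x(0 := x 0 + (- a)))"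
    by (intro AE_laplace_sequence_shift \<open>\<sigma> 0 = 1\<close>) measurable
  then have "AE w in \<nu>. P (?\<Phi> (w - C v))"
    unfolding translate by (subst (asm) AE_law) measurable
  then have "AE w in \<nu>. w \<notin> cball (h + C v) r"
    by eventually_elim (simp only: P_iff, simp add: dist_norm algebra_simps)
  then show ?thesis
    using sets_\<nu> by (subst (asm) AE_iff_measurable[OF _ refl]) (auto simp: cball_def)
qed (use null in simp)

lemma support_nonempty: "measure_support \<nu> \<noteq> {}"
proof
  assume empty: "measure_support \<nu> = {}"
  let ?F = "{U. open U \<and> emeasure \<nu> U = 0}"
  have cover: "\<Union>?F = UNIV"
    using empty by (auto simp: measure_support_def not_gr_zero)
  obtain F where F: "F \<subseteq> ?F" "countable F" "\<Union>F = \<Union>?F"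
    by (rule Lindelof[of ?F]) auto
  have "(\<Union>U\<in>F. U) \<in> null_sets \<nu>"
    using F by (intro null_sets_UN') (auto simp: null_sets_def sets_\<nu>)
  then show False
    using F cover emeasure_space_1 by (simp add: null_sets_def)
qed

text \<open>
  From a point \<open>h\<close> of the support, translations by elements of the range of \<open>C\<close> come arbitrarily close
  to any given point \<open>z\<close>. A null ball around \<open>z\<close> would therefore contain a translate of some ball
  around \<open>h\<close>, which would be null as well.
\<close>

theorem full_support: "measure_support \<nu> = UNIV"
proof (rule ccontr)
  assume "measure_support \<nu> \<noteq> UNIV"
  then obtain z U where U: "open U" "z \<in> U" "emeasure \<nu> U = 0"
    unfolding measure_support_def by (auto simp: zero_less_iff_neq_zero)
  then obtain e where e: "e > 0" "cball z e \<subseteq> U"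
    using open_contains_cball by blast
  obtain h where h: "h \<in> measure_support \<nu>"
    using support_nonempty by blast
  have "closure (range C) = UNIV"
    by (rule dense_subspace_if_orthogonal_complement_trivial)
       (use linear orthogonal_range_imp_zero in \<open>blast intro: linear_subspace_image subspace_UNIV\<close>)+
  then have "z - h \<in> closure (range C)" by simp
  then obtain v where v: "dist (C v) (z - h) < e / 2"
    using e closure_approachable[of "z - h" "range C"] by (metis half_gt_zero rangeE)
  have "cball (h + C v) (e / 2) \<subseteq> cball z e"
  proof
    fix w assume "w \<in> cball (h + C v) (e / 2)"
    then have "dist (h + C v) w \<le> e / 2" by simp
    moreover have "dist z (h + C v) < e / 2"
      using v by (simp add: dist_norm norm_minus_commute algebra_simps)
    ultimately show "w \<in> cball z e"
      using dist_triangle[of z w "h + C v"] by simp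
  qed
  then have "emeasure \<nu> (cball (h + C v) (e / 2)) = 0"
    using U e emeasure_mono[of "cball (h + C v) (e / 2)" U \<nu>] sets_\<nu> by auto
  then have "emeasure \<nu> (cball h (e / 2)) = 0"
    using cball_null_translate[of "h + C v" "e / 2" "- v"] e linear by (simp add: linear_neg)
  then have "emeasure \<nu> (ball h (e / 2)) = 0"
    using emeasure_mono[of "ball h (e / 2)" "cball h (e / 2)" \<nu>] sets_\<nu> by auto
  then show False
    using h e by (auto simp: measure_support_def dest!: spec[of _ "ball h (e / 2)"])
qed

end

section \<open>The support of a Laplace measure\<close>

theorem proposition2p8:
  fixes \<nu> :: "'a::{real_inner, polish_space} measure"
    and C :: "'a \<Rightarrow> 'a"
    and lam :: "nat \<Rightarrow> real"
    and P :: "nat \<Rightarrow> 'b measure"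
    and L L' :: "nat \<Rightarrow> 'b \<Rightarrow> nat \<Rightarrow> real"
  assumes infinite_dim: "\<not> (\<exists>B::'a set. finite B \<and> span B = UNIV)"
    and laplace: "laplace_measure \<nu>"
    and mean_zero: "is_mean \<nu> 0"
    and symmetric: "symmetric_measure \<nu>"
    and covariance: "is_covariance_operator \<nu> 0 C"
    and eigenvalues: "eigenvalues_with_multiplicity C lam"
    and prob: "\<And>M. M \<ge> 1 \<Longrightarrow> prob_space (P M)"
    and indep: "\<And>M. M \<ge> 1 \<Longrightarrow>
          prob_space.indep_var (P M) (PiM {..<M} (\<lambda>_. borel)) (L M) (PiM {..<M} (\<lambda>_. borel)) (L' M)"
    and ident_distr: "\<And>M. M \<ge> 1 \<Longrightarrow>
          distr (P M) (PiM {..<M} (\<lambda>_. borel)) (L' M) = distr (P M) (PiM {..<M} (\<lambda>_. borel)) (L M)"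
    and laplace_vec: "\<And>M. M \<ge> 1 \<Longrightarrow>
          multivariate_laplace M (\<lambda>_. 0) (\<lambda>j k. if j = k then 1 else 0)
            (distr (P M) (PiM {..<M} (\<lambda>_. borel)) (L M))"
    and ratio: "\<And>r w. r \<noteq> 0 \<Longrightarrow> summable (\<lambda>k. (w k)\<^sup>2) \<Longrightarrow>
          limsup (\<lambda>M. ereal (
              \<P>(\<omega> in P M. (\<Sum>k<M. (sqrt (lam k) * (L M \<omega> k + L' M \<omega> k) - w k)\<^sup>2) \<le> r\<^sup>2) /
              \<P>(\<omega> in P M. (\<Sum>k<M. (sqrt (lam k) * L M \<omega> k - w k)\<^sup>2) \<le> r\<^sup>2))) < \<infinity>"
  shows "measure_support \<nu> = UNIV"
proof -
  interpret centered_laplace_measure \<nu> C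
    using laplace mean_zero covariance by unfold_locales
  show ?thesis by (rule full_support)
qed

end
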